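(* For every finite simplicial complex $K$ and every integer $r\geq 1$ there exists a finite simple graph $G$ such that $\mathrm{Cl}(G^r)$ is homotopy equivalent to $K$.
   Context: $G^r$ denotes the $r$-th distance power of $G$: the graph on the vertex set $V(G)$ in which two distinct vertices are adjacent iff their distance in $G$ is at most $r$. The clique complex $\mathrm{Cl}(G)$ is the simplicial complex on $V(G)$ whose simplices are the cliques of $G$. Simplicial complexes are identified with their geometric realizations. *)

theory Defs
  imports
    "HOL-Analysis.Analysis"
    "Graph_Theory.Pair_Digraph"
    "Graph_Theory.Shortest_Path"
begin

text \<open>
  Abstract simplicial complexes. The empty set is not counted as a simplex, so the vertex set
  of \<open>K\<close> is \<open>\<Union>K\<close>. The complex without vertices (\<open>K = {}\<close>) is allowed.
\<close>

definition abstract_simplicial_complex :: "'a set set \<Rightarrow> bool" where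
  "abstract_simplicial_complex K \<longleftrightarrow>
     (\<forall>\<sigma>\<in>K. finite \<sigma> \<and> \<sigma> \<noteq> {}) \<and>
     (\<forall>\<sigma>\<in>K. \<forall>\<tau>. \<tau> \<subseteq> \<sigma> \<and> \<tau> \<noteq> {} \<longrightarrow> \<tau> \<in> K)"

definition finite_simplicial_complex :: "'a set set \<Rightarrow> bool" where
  "finite_simplicial_complex K \<longleftrightarrow> abstract_simplicial_complex K \<and> finite K"

text \<open>
  Points of the geometric realization in barycentric coordinates, with coordinate 0 outside the
  vertex set (the convention of \<open>standard_simplex\<close> in HOL-Homology). The subspace topology
  of the product topology is the usual topology of the realization only because the complexes
  considered here are finite.
\<close>

definition realization_points :: "'a set set \<Rightarrow> ('a \<Rightarrow> real) set" where
  "realization_points K =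
     {x. (\<forall>v. 0 \<le> x v) \<and> {v. x v \<noteq> 0} \<in> K \<and> (\<Sum>v | x v \<noteq> 0. x v) = 1}"

definition geometric_realization :: "'a set set \<Rightarrow> ('a \<Rightarrow> real) topology" where
  "geometric_realization K = subtopology (powertop_real UNIV) (realization_points K)"

text \<open>
  Finite simple graphs are represented by the locale \<open>pair_graph\<close>: finite, loop-free, with a
  symmetric set of arcs. The distance is the infimum of the numbers of arcs of walks; it is
  \<open>\<infinity>\<close> between different components. The definition of \<open>wf_digraph.\<mu>\<close> requires
  \<open>wf_digraph\<close>, which holds for every \<open>pair_graph\<close>.
\<close>

definition graph_dist :: "'a pair_pre_digraph \<Rightarrow> 'a \<Rightarrow> 'a \<Rightarrow> ereal" where
  "graph_dist G u v = wf_digraph.\<mu> (with_proj G) (\<lambda>_. 1) u v"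

definition distance_power :: "'a pair_pre_digraph \<Rightarrow> nat \<Rightarrow> 'a pair_pre_digraph" where
  "distance_power G r =
     \<lparr> pverts = pverts G,
       parcs = {(u, v). u \<in> pverts G \<and> v \<in> pverts G \<and> u \<noteq> v \<and> graph_dist G u v \<le> ereal (real r)} \<rparr>"

definition is_clique :: "'a pair_pre_digraph \<Rightarrow> 'a set \<Rightarrow> bool" where
  "is_clique G \<sigma> \<longleftrightarrow>
     \<sigma> \<subseteq> pverts G \<and> (\<forall>u\<in>\<sigma>. \<forall>v\<in>\<sigma>. u \<noteq> v \<longrightarrow> (u, v) \<in> parcs G)"

definition clique_complex :: "'a pair_pre_digraph \<Rightarrow> 'a set set" where
  "clique_complex G = {\<sigma>. finite \<sigma> \<and> \<sigma> \<noteq> {} \<and> is_clique G \<sigma>}"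

lemma finite_simplicial_complex_clique_complex:
  assumes "finite (pverts G)"
  shows "finite_simplicial_complex (clique_complex G)"
proof -
  have "clique_complex G \<subseteq> Pow (pverts G)"
    by (auto simp: clique_complex_def is_clique_def)
  then have "finite (clique_complex G)"
    using assms by (meson finite_Pow_iff finite_subset)
  then show ?thesis
    by (auto simp: finite_simplicial_complex_def abstract_simplicial_complex_def
        clique_complex_def is_clique_def intro: finite_subset)
qed

lemma graph_dist_le_iff:
  assumes "pair_graph G"
  shows "graph_dist G u v \<le> ereal (real r) \<longleftrightarrow>
    (\<exists>p. pre_digraph.awalk (with_proj G) u p v \<and> length p \<le> r)"
proof -
  interpret pair_graph G by fact
  have cost: "awalk_cost (\<lambda>_. 1) p = real (length p)" for p :: "('a \<times> 'a) list"
    by (induct p) (auto simp: awalk_cost_def)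
  have \<mu>: "graph_dist G u v = (INF p\<in>{p. awalk u p v}. ereal (real (length p)))"
    by (simp add: graph_dist_def \<mu>_def cost)
  show ?thesis
  proof
    assume "graph_dist G u v \<le> ereal (real r)"
    then have "graph_dist G u v < ereal (real (Suc r))"
      by (rule order.strict_trans1) simp
    then obtain p where "awalk u p v" "length p < Suc r"
      unfolding \<mu> INF_less_iff by auto
    then show "\<exists>p. awalk u p v \<and> length p \<le> r"
      by auto
  next
    assume "\<exists>p. awalk u p v \<and> length p \<le> r"
    then show "graph_dist G u v \<le> ereal (real r)"
      unfolding \<mu> by (auto intro!: INF_lower2)
  qed
qed

lemma pair_graph_distance_power:
  assumes "pair_graph G"
  shows "pair_graph (distance_power G r)"
proof -
  interpret pair_graph G by fact
  have rev: "\<exists>q. awalk y q x \<and> length q \<le> n" if "awalk x p y" "length p \<le> n" for x p y n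
    using that
  proof (induct p arbitrary: x n)
    case Nil
    then show ?case by (intro exI[of _ "[]"]) (auto simp: awalk_Nil_iff)
  next
    case (Cons e p)
    then obtain m where n: "n = Suc m" by (cases n) auto
    from Cons.prems have e: "e \<in> parcs G" "x = fst e" "awalk (snd e) p y"
      by (auto simp: awalk_Cons_iff)
    with Cons.hyps[of "snd e" m] Cons.prems n obtain q where q: "awalk y q (snd e)" "length q \<le> m"
      by auto
    have "(snd e, fst e) \<in> parcs G"
      using arcs_symmetric e(1) by (metis prod.collapse)
    then have "awalk (snd e) [(snd e, fst e)] x"
      using e(2) by (auto simp: awalk_Cons_iff awalk_Nil_iff intro: in_arcsD2)
    with q(1) have "awalk y (q @ [(snd e, fst e)]) x"
      by (rule awalk_appendI)
    with q(2) n show ?case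
      by (intro exI[of _ "q @ [(snd e, fst e)]"]) simp
  qed
  have sub: "parcs (distance_power G r) \<subseteq> pverts G \<times> pverts G"
    by (auto simp: distance_power_def)
  have "symmetric (with_proj (distance_power G r))"
    unfolding symmetric_def
    by (rule symI) (use rev in \<open>auto simp: distance_power_def graph_dist_le_iff[OF assms]\<close>)
  then show ?thesis
    using sub pair_finite_verts
    by unfold_locales
      (auto simp: distance_power_def intro: finite_subset[OF _ finite_cartesian_product])
qed

end

theory Submission
  imports Defs
begin

text \<open>
  Let \<open>M = 3r + 1\<close> and let the vertices of \<open>G\<close> be the integer points \<open>x\<close> of the cube \<open>[0, M]\<^sup>V\<close>
  with support in \<open>K\<close> and largest coordinate \<open>M\<close>, two of them being adjacent when all coordinates
  differ by at most 1. If \<open>\<sigma>\<close> is a clique of \<open>G\<^sup>r\<close> and the \<open>v\<close>-coordinate of the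
  barycentre of some point of \<open>|\<sigma>|\<close> exceeds \<open>2r\<close>, then every vertex of \<open>\<sigma>\<close> has
  \<open>v\<close>-coordinate above \<open>r\<close>. So cutting barycentres off at \<open>2r\<close> and normalising gives a
  map \<open>|Cl(G\<^sup>r)| \<rightarrow> |K|\<close>. In the other direction a point of \<open>|K|\<close> is rescaled to the
  cube and interpolated multilinearly between the corners of its unit cube.

  One composite is homotopic to the identity by straight lines in \<open>|K|\<close>. For the other one, let
  \<open>y\<close> be the image in \<open>|K|\<close> of a point of \<open>|\<sigma>|\<close>, rescaled to the cube. Clamping
  all vertices of \<open>\<sigma>\<close> to a box moves them to \<open>y\<close>: raise the lower corner of the box from \<open>0\<close>
  to \<open>y\<close>, then lower the upper corner from \<open>(M, \<dots>, M)\<close> to \<open>y\<close>. Clamping is nonexpanding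
  even after rounding, and paths of length at most \<open>r\<close> between vertices of \<open>\<sigma>\<close> stay where the
  support of \<open>y\<close> is positive, so that they can be clamped as well. Hence cliques go to cliques.
\<close>

section \<open>Points of realizations and straight-line homotopies\<close>

lemma geometric_realization_eq_top_of_set:
  "geometric_realization K = top_of_set (realization_points K)"
  by (simp add: geometric_realization_def euclidean_product_topology)

text \<open>A total of 1 makes the support nonempty, so it is a face of any simplex
  \<open>\<sigma>\<close> containing it.\<close>

lemma realization_pointsI:
  assumes "abstract_simplicial_complex K" "\<sigma> \<in> K"
    and "\<And>v. 0 \<le> x v" "{v. x v \<noteq> 0} \<subseteq> \<sigma>" "(\<Sum>v\<in>\<sigma>. x v) = 1"
  shows "x \<in> realization_points K"
proof -
  have fin: "finite \<sigma>"
    using assms(1,2) by (auto simp: abstract_simplicial_complex_def)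
  have sum: "(\<Sum>v | x v \<noteq> 0. x v) = 1"
    using sum.mono_neutral_left[OF fin assms(4), of x] assms(5) by auto
  then have "{v. x v \<noteq> 0} \<noteq> {}"
    by (metis sum.empty zero_neq_one)
  then have "{v. x v \<noteq> 0} \<in> K"
    using assms(1,2,4) unfolding abstract_simplicial_complex_def by blast
  with assms(3) sum show ?thesis
    by (auto simp: realization_points_def)
qed

lemma realization_points_sum:
  assumes "x \<in> realization_points K" "finite S" "{v. x v \<noteq> 0} \<subseteq> S"
  shows "(\<Sum>v\<in>S. x v) = 1"
proof -
  have "(\<Sum>v | x v \<noteq> 0. x v) = (\<Sum>v\<in>S. x v)"
    by (rule sum.mono_neutral_left) (use assms in auto)
  with assms(1) show ?thesis
    by (auto simp: realization_points_def)
qed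

text \<open>The segment from \<open>f x\<close> to \<open>g x\<close> never leaves the closed
  simplex spanned by the support of \<open>f x\<close>.\<close>

lemma homotopic_straight_line_realization:
  fixes f g :: "'b::topological_space \<Rightarrow> 'a \<Rightarrow> real"
  assumes K: "abstract_simplicial_complex K"
    and cont: "continuous_on S f" "continuous_on S g"
    and f: "\<And>x. x \<in> S \<Longrightarrow> f x \<in> realization_points K"
    and g: "\<And>x. x \<in> S \<Longrightarrow> g x \<in> realization_points K"
    and supp: "\<And>x v. x \<in> S \<Longrightarrow> g x v \<noteq> 0 \<Longrightarrow> f x v \<noteq> 0"
  shows "homotopic_with_canon (\<lambda>_. True) S (realization_points K) f g"
proof -
  define h where "h = (\<lambda>(t::real, x) v. (1 - t) * f x v + t * g x v)"
  have coord: "continuous_on ({0..1::real} \<times> S) (\<lambda>p. F (snd p) v)"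
    if "continuous_on S F" for F :: "'b \<Rightarrow> 'a \<Rightarrow> real" and v
    by (rule continuous_on_product_then_coordinatewise,
        rule continuous_on_compose2[OF that continuous_on_snd[OF continuous_on_id]]) auto
  have "continuous_on ({0..1::real} \<times> S) (\<lambda>p v. (1 - fst p) * f (snd p) v + fst p * g (snd p) v)"
    by (intro continuous_on_coordinatewise_then_product continuous_intros coord cont)
  then have cont_h: "continuous_on ({0..1::real} \<times> S) h"
    by (simp add: h_def case_prod_beta')
  have "h (t, x) \<in> realization_points K" if "t \<in> {0..1}" "x \<in> S" for t x
  proof (rule realization_pointsI[OF K, of "{v. f x v \<noteq> 0}"])
    show \<sigma>: "{v. f x v \<noteq> 0} \<in> K"
      using f[OF that(2)] by (auto simp: realization_points_def)
    then have fin: "finite {v. f x v \<noteq> 0}"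
      using K by (auto simp: abstract_simplicial_complex_def)
    show "0 \<le> h (t, x) v" for v
      using f[OF that(2)] g[OF that(2)] that(1) by (auto simp: h_def realization_points_def)
    show "{v. h (t, x) v \<noteq> 0} \<subseteq> {v. f x v \<noteq> 0}"
      using supp[OF that(2)] by (auto simp: h_def)
    have "(\<Sum>v | f x v \<noteq> 0. h (t, x) v)
        = (1 - t) * (\<Sum>v | f x v \<noteq> 0. f x v) + t * (\<Sum>v | f x v \<noteq> 0. g x v)"
      by (simp add: h_def sum.distrib sum_distrib_left)
    also have "\<dots> = 1"
      using realization_points_sum[OF f[OF that(2)] fin] supp[OF that(2)]
        realization_points_sum[OF g[OF that(2)] fin] by auto
    finally show "(\<Sum>v | f x v \<noteq> 0. h (t, x) v) = 1" .
  qed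
  with cont_h show ?thesis
    unfolding homotopic_with_def
    by (intro exI[of _ h]) (auto simp: h_def)
qed

section \<open>Hat functions and clamping on the real line\<close>

definition hat :: "real \<Rightarrow> real" where
  "hat t = max 0 (1 - \<bar>t\<bar>)"

lemma hat_nonneg: "0 \<le> hat t"
  by (simp add: hat_def)

lemma hat_neq_0_iff: "hat t \<noteq> 0 \<longleftrightarrow> \<bar>t\<bar> < 1"
  by (auto simp: hat_def)

text \<open>Only the integers \<open>j\<close> and \<open>j + 1\<close> around \<open>t\<close>
  contribute, with weights \<open>1 - (t - j)\<close> and \<open>t - j\<close>. If
  \<open>j + 1\<close> exceeds \<open>m\<close>, then \<open>t = m\<close> and \<open>j\<close>
  alone has weight 1.\<close>

lemma sum_hat:
  assumes "0 \<le> t" "t \<le> real m"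
  shows "(\<Sum>k\<le>m. hat (t - real k)) = 1"
proof -
  define j where "j = nat \<lfloor>t\<rfloor>"
  have j: "real j \<le> t" "t < real j + 1"
    using assms by (auto simp: j_def)
  have "(\<Sum>k\<le>m. hat (t - real k)) = (\<Sum>k\<in>{j, Suc j} \<inter> {..m}. hat (t - real k))"
  proof (rule sum.mono_neutral_right)
    show "\<forall>k\<in>{..m} - {j, Suc j} \<inter> {..m}. hat (t - real k) = 0"
    proof
      fix k assume "k \<in> {..m} - {j, Suc j} \<inter> {..m}"
      then have "real k + 1 \<le> real j \<or> real j + 2 \<le> real k"
        by auto
      then show "hat (t - real k) = 0"
        using j by (auto simp: hat_def)
    qed
  qed auto
  also have "\<dots> = 1"
  proof (cases "Suc j \<le> m")
    case True
    then have "{j, Suc j} \<inter> {..m} = {j, Suc j}" by auto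
    then show ?thesis using j by (auto simp: hat_def)
  next
    case False
    with j assms have "j = m" "t = real m" by auto
    moreover have "{m, Suc m} \<inter> {..m} = {m}" by auto
    ultimately show ?thesis by (auto simp: hat_def)
  qed
  finally show ?thesis .
qed

definition clamp :: "real \<Rightarrow> real \<Rightarrow> real \<Rightarrow> real" where
  "clamp a b t = max a (min t b)"

text \<open>Clamping maps each interval \<open>[n, n + 1]\<close> into an interval between consecutive integers.\<close>

lemma clamp_rounding:
  fixes n m w w' :: nat
  assumes "n \<le> m + 1" "m \<le> n + 1" "a \<le> b"
    and "\<bar>clamp a b (real n) - real w\<bar> < 1" "\<bar>clamp a b (real m) - real w'\<bar> < 1"
  shows "w \<le> w' + 1"
proof (rule ccontr)
  assume "\<not> w \<le> w' + 1"
  then have "real w \<ge> real w' + 2" by linarith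
  \<comment> \<open>The integer \<open>w' + 1\<close> would lie strictly between the clamped values
    of two equal or consecutive integers.\<close>
  with assms(4,5) have less: "clamp a b (real n) > real w' + 1" "clamp a b (real m) < real w' + 1"
    by linarith+
  then have "n \<noteq> m" by auto
  with assms(1,2) consider "n = m + 1" | "m = n + 1" by linarith
  then show False
  proof cases
    case 1
    then have "real m < real (w' + 1)" "real w' < real m"
      using less assms(3) by (auto simp: clamp_def max_def min_def split: if_splits)
    then show False
      unfolding of_nat_less_iff by auto
  next
    case 2
    then show False
      using less assms(3) by (auto simp: clamp_def max_def min_def split: if_splits)
  qed
qed

section \<open>Cubical model of the realization and its integer points\<close>

definition grid :: "'a set set \<Rightarrow> nat \<Rightarrow> ('a \<Rightarrow> nat) set" where
  "grid K m = {x. {v. x v \<noteq> 0} \<in> K \<and> (\<forall>v. x v \<le> m) \<and> (\<exists>v. x v = m)}"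

text \<open>For \<open>m > 0\<close> this is a radial copy of the realization on the faces of the
  cube away from the origin.\<close>

definition real_grid :: "'a set set \<Rightarrow> nat \<Rightarrow> ('a \<Rightarrow> real) set" where
  "real_grid K m = {x. {v. x v \<noteq> 0} \<in> K \<and> (\<forall>v. 0 \<le> x v \<and> x v \<le> real m) \<and> (\<exists>v. x v = real m)}"

text \<open>Since the inequality is strict, integer coordinates of \<open>\<zeta>\<close> are kept.
  Thus a coordinate \<open>m\<close> survives, and zeros stay zeros, so the support can only shrink
  to a face.\<close>

lemma grid_if_near_real_grid:
  assumes K: "abstract_simplicial_complex K" and "m > 0" and "\<zeta> \<in> real_grid K m"
    and near: "\<And>v. \<bar>\<zeta> v - real (x v)\<bar> < 1"
  shows "x \<in> grid K m"
proof -
  obtain u where u: "\<zeta> u = real m"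
    using assms(3) by (auto simp: real_grid_def)
  have bounds: "0 \<le> \<zeta> v" "\<zeta> v \<le> real m" for v
    using assms(3) by (auto simp: real_grid_def)
  have le: "x v \<le> m" for v
    using near[of v] bounds[of v] by linarith
  have xu: "x u = m"
    using near[of u] le[of u] u by linarith
  have "{v. x v \<noteq> 0} \<subseteq> {v. \<zeta> v \<noteq> 0}"
  proof
    fix v assume "v \<in> {v. x v \<noteq> 0}"
    with near[of v] show "v \<in> {v. \<zeta> v \<noteq> 0}"
      by (cases "x v") auto
  qed
  moreover have "{v. x v \<noteq> 0} \<noteq> {}"
    using xu \<open>m > 0\<close> by auto
  moreover have "{v. \<zeta> v \<noteq> 0} \<in> K"
    using assms(3) by (auto simp: real_grid_def)
  ultimately have "{v. x v \<noteq> 0} \<in> K"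
    using K unfolding abstract_simplicial_complex_def by blast
  with le xu show ?thesis
    by (auto simp: grid_def)
qed

lemma real_grid_rounding_exists:
  assumes "abstract_simplicial_complex K" "m > 0" "\<zeta> \<in> real_grid K m"
  shows "\<exists>x\<in>grid K m. \<forall>v. \<bar>\<zeta> v - real (x v)\<bar> < 1"
proof -
  have "0 \<le> \<zeta> v" for v
    using assms(3) by (auto simp: real_grid_def)
  moreover have "\<bar>t - real_of_int \<lfloor>t\<rfloor>\<bar> < 1" for t :: real
    by linarith
  ultimately have "\<bar>\<zeta> v - real (nat \<lfloor>\<zeta> v\<rfloor>)\<bar> < 1" for v
    by simp
  with grid_if_near_real_grid[OF assms, of "\<lambda>v. nat \<lfloor>\<zeta> v\<rfloor>"] show ?thesis
    by (intro bexI[of _ "\<lambda>v. nat \<lfloor>\<zeta> v\<rfloor>"]) auto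
qed

lemma finite_Union_simplicial_complex:
  assumes "finite_simplicial_complex K"
  shows "finite (\<Union>K)"
  using assms by (auto simp: finite_simplicial_complex_def abstract_simplicial_complex_def)

lemma grid_zero_outside:
  assumes "x \<in> grid K m" "v \<notin> \<Union>K"
  shows "x v = 0"
  using assms by (auto simp: grid_def)

lemma finite_grid:
  assumes "finite_simplicial_complex K"
  shows "finite (grid K m)"
proof (rule finite_subset)
  show "grid K m \<subseteq> {x. \<forall>v. (v \<in> \<Union>K \<longrightarrow> x v \<in> {..m}) \<and> (v \<notin> \<Union>K \<longrightarrow> x v = 0)}"
    using grid_zero_outside[of _ K m] by (auto simp: grid_def)
  show "finite \<dots>"
    by (rule finite_set_of_finite_funs) (use finite_Union_simplicial_complex[OF assms] in auto)
qed

text \<open>Over all integer points of the cube the sum factors into one-dimensional sums equal to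
  1. Points of nonzero weight are near \<open>\<zeta>\<close> and hence in the grid, so nothing is
  lost by summing over the grid only.\<close>

lemma sum_prod_hat:
  assumes K: "finite_simplicial_complex K" and "m > 0" "\<zeta> \<in> real_grid K m"
  shows "(\<Sum>x\<in>grid K m. \<Prod>v\<in>\<Union>K. hat (\<zeta> v - real (x v))) = 1"
proof -
  let ?V = "\<Union>K" and ?F = "\<lambda>x. \<Prod>v\<in>\<Union>K. hat (\<zeta> v - real (x v))"
  have fin: "finite ?V"
    by (rule finite_Union_simplicial_complex[OF K])
  have asc: "abstract_simplicial_complex K"
    using K by (simp add: finite_simplicial_complex_def)
  have \<zeta>0: "\<zeta> v = 0" if "v \<notin> ?V" for v
    using assms(3) that by (auto simp: real_grid_def)
  \<comment> \<open>Outside \<open>?V\<close>, grid points are 0 but members of the function space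
    \<open>PiE\<close> are \<open>undefined\<close>; restriction translates between the two.\<close>
  have inj: "inj_on (\<lambda>x. restrict x ?V) (grid K m)"
  proof (rule inj_onI)
    fix x y assume xy: "x \<in> grid K m" "y \<in> grid K m" "restrict x ?V = restrict y ?V"
    show "x = y"
    proof
      fix v show "x v = y v"
        using grid_zero_outside[OF xy(1)] grid_zero_outside[OF xy(2)] fun_cong[OF xy(3), of v]
        by (cases "v \<in> ?V") (simp_all add: restrict_def)
    qed
  qed
  have "(\<Sum>x\<in>grid K m. ?F x) = (\<Sum>x\<in>(\<lambda>x. restrict x ?V) ` grid K m. ?F x)"
    by (subst sum.reindex[OF inj]) (auto intro!: sum.cong prod.cong)
  also have "\<dots> = (\<Sum>x\<in>?V \<rightarrow>\<^sub>E {..m}. ?F x)"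
  proof (rule sum.mono_neutral_left)
    show "finite (?V \<rightarrow>\<^sub>E {..m})"
      by (rule finite_PiE[OF fin]) auto
    show "(\<lambda>x. restrict x ?V) ` grid K m \<subseteq> ?V \<rightarrow>\<^sub>E {..m}"
      by (auto simp: grid_def)
    show "\<forall>x\<in>(?V \<rightarrow>\<^sub>E {..m}) - (\<lambda>x. restrict x ?V) ` grid K m. ?F x = 0"
    proof (rule ballI, rule ccontr)
      fix x assume x: "x \<in> (?V \<rightarrow>\<^sub>E {..m}) - (\<lambda>x. restrict x ?V) ` grid K m" and "?F x \<noteq> 0"
      define y where "y v = (if v \<in> ?V then x v else 0)" for v
      have "\<bar>\<zeta> v - real (y v)\<bar> < 1" for v
        using \<open>?F x \<noteq> 0\<close> fin \<zeta>0[of v] by (auto simp: y_def hat_neq_0_iff)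
      then have "y \<in> grid K m"
        by (rule grid_if_near_real_grid[OF asc assms(2,3)])
      moreover have "x = restrict y ?V"
        using x by (auto simp: y_def fun_eq_iff PiE_def extensional_def)
      ultimately show False
        using x by auto
    qed
  qed
  also have "\<dots> = (\<Prod>v\<in>?V. \<Sum>k\<le>m. hat (\<zeta> v - real k))"
    by (rule prod_sum_PiE [symmetric]) (use fin in auto)
  also have "\<dots> = 1"
    using assms(3) by (intro prod.neutral ballI sum_hat) (auto simp: real_grid_def)
  finally show ?thesis .
qed


section \<open>Distances as powers of a reflexive relation\<close>

text \<open>Loops of \<open>E\<close> pad a short walk to exactly \<open>r\<close> steps;
  conversely, deleting the loops of a chain leaves a walk of length at most
  \<open>r\<close>.\<close>

lemma graph_dist_le_iff_relpow:
  assumes G: "pair_graph G" and E: "parcs G = E - Id" "E \<subseteq> pverts G \<times> pverts G"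
    and refl: "\<And>u. u \<in> pverts G \<Longrightarrow> (u, u) \<in> E"
    and u: "u \<in> pverts G"
  shows "graph_dist G u v \<le> ereal (real r) \<longleftrightarrow> (u, v) \<in> E ^^ r"
proof -
  interpret pair_graph G by fact
  have pad: "(x, y) \<in> E ^^ (l + k)" if "(x, y) \<in> E ^^ l" "y \<in> pverts G" for x y l k
    using that by (induct k) (auto intro: refl)
  have relpow_of: "(x, y) \<in> E ^^ length p \<and> y \<in> pverts G" if "awalk x p y" for x p y
    using that
  proof (induct p arbitrary: x)
    case (Cons e p)
    then have "e \<in> parcs G" "x = fst e" "(snd e, y) \<in> E ^^ length p" "y \<in> pverts G"
      by (auto simp: awalk_Cons_iff)
    then show ?case
      using E(1) by (cases e) (auto simp del: relpow.simps intro: relpow_Suc_I2)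
  qed (auto simp: awalk_Nil_iff)
  have awalk_of: "\<exists>p. awalk x p y \<and> length p \<le> l" if "(x, y) \<in> E ^^ l" "x \<in> pverts G" for x y l
    using that
  proof (induct l arbitrary: x)
    case 0
    then show ?case by (intro exI[of _ "[]"]) (auto simp: awalk_Nil_iff)
  next
    case (Suc l)
    then obtain z where z: "(x, z) \<in> E" "(z, y) \<in> E ^^ l"
      by (meson relpow_Suc_D2)
    with Suc.hyps[of z] E(2) obtain p where p: "awalk z p y" "length p \<le> l"
      by blast
    show ?case
    proof (cases "x = z")
      case True
      with p show ?thesis by auto
    next
      case False
      with z(1) p E(1) show ?thesis
        by (intro exI[of _ "(x, z) # p"]) (auto simp: awalk_Cons_iff)
    qed
  qed
  show ?thesis
    unfolding graph_dist_le_iff[OF G] using relpow_of pad awalk_of[OF _ u]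
    by (metis le_add_diff_inverse)
qed

section \<open>The grid graph and the cliques of its power\<close>

text \<open>The vertices of the graph are to be natural numbers, so \<open>c\<close> numbers the
  grid points.\<close>

locale grid_graph =
  fixes K :: "'a set set" and r :: nat and D :: "nat set" and c :: "nat \<Rightarrow> 'a \<Rightarrow> nat"
  assumes K: "finite_simplicial_complex K"
    and r: "r \<ge> 1"
    and c: "bij_betw c D (grid K (3 * r + 1))"
begin

text \<open>A walk of \<open>r\<close> steps lowers a coordinate by at most \<open>r\<close>: from
  \<open>M\<close> it stays above the cut-off \<open>2 * r\<close>, from above \<open>2 * r\<close>
  it stays above \<open>r\<close>, and from above \<open>r\<close> it stays positive. Each of these
  three margins is used once.\<close>

abbreviation "M \<equiv> 3 * r + 1"

text \<open>\<open>E\<close> is reflexive on \<open>D\<close>, so distance at most \<open>r\<close> is membership in \<open>E ^^ r\<close>.\<close>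

definition E :: "nat rel" where
  "E = {(n, m). n \<in> D \<and> m \<in> D \<and> (\<forall>v. c n v \<le> c m v + 1 \<and> c m v \<le> c n v + 1)}"

definition G :: "nat pair_pre_digraph" where
  "G = \<lparr> pverts = D, parcs = E - Id \<rparr>"

abbreviation "L \<equiv> clique_complex (distance_power G r)"

lemma complex_K: "abstract_simplicial_complex K"
  using K by (simp add: finite_simplicial_complex_def)

lemma finite_V: "finite (\<Union>K)"
  by (rule finite_Union_simplicial_complex[OF K])

lemma finite_D: "finite D"
  using c finite_grid[OF K] bij_betw_finite by blast

lemma c_grid: "n \<in> D \<Longrightarrow> c n \<in> grid K M"
  using c by (auto simp: bij_betw_def)

lemma c_le: "n \<in> D \<Longrightarrow> c n v \<le> M"
  using c_grid by (auto simp: grid_def)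

lemma c_supp: "n \<in> D \<Longrightarrow> {v. c n v \<noteq> 0} \<in> K"
  using c_grid by (auto simp: grid_def)

lemma c_max: "n \<in> D \<Longrightarrow> \<exists>v. c n v = M"
  using c_grid by (auto simp: grid_def)

lemma c_outside: "n \<in> D \<Longrightarrow> v \<notin> \<Union>K \<Longrightarrow> c n v = 0"
  using c_grid grid_zero_outside by metis

lemma pair_graph_G: "pair_graph G"
proof -
  have "finite (E - Id)"
    by (rule finite_subset[of _ "D \<times> D"]) (auto simp: E_def finite_D)
  moreover have "symmetric (with_proj G)"
    unfolding symmetric_def by (rule symI) (auto simp: G_def E_def)
  ultimately show ?thesis
    using finite_D by unfold_locales (auto simp: G_def E_def)
qed

lemma relpow_E_D: "(n, m) \<in> E ^^ l \<Longrightarrow> n \<in> D \<Longrightarrow> m \<in> D"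
proof (induct l arbitrary: m)
  case (Suc l)
  then obtain k where "(k, m) \<in> E" by auto
  then show ?case by (simp add: E_def)
qed simp

lemma relpow_E_le: "(n, m) \<in> E ^^ l \<Longrightarrow> c n v \<le> c m v + l"
proof (induct l arbitrary: m)
  case (Suc l)
  then obtain k where "(n, k) \<in> E ^^ l" "(k, m) \<in> E" by auto
  with Suc.hyps[of k] have "c n v \<le> c k v + l" "c k v \<le> c m v + 1"
    by (auto simp: E_def)
  then show ?case by simp
qed auto

lemma parcs_distance_power_G:
  "(n, m) \<in> parcs (distance_power G r) \<longleftrightarrow> n \<in> D \<and> m \<in> D \<and> n \<noteq> m \<and> (n, m) \<in> E ^^ r"
proof -
  have "graph_dist G n m \<le> ereal (real r) \<longleftrightarrow> (n, m) \<in> E ^^ r" if "n \<in> D"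
    by (rule graph_dist_le_iff_relpow[OF pair_graph_G]) (use that in \<open>auto simp: G_def E_def\<close>)
  then show ?thesis
    by (auto simp: distance_power_def G_def)
qed

lemma relpow_E_refl: "n \<in> D \<Longrightarrow> (n, n) \<in> E ^^ l"
proof (induct l)
  case (Suc l)
  moreover have "(n, n) \<in> E"
    using Suc.prems by (simp add: E_def)
  ultimately show ?case by auto
qed simp

lemma clique_complex_iff:
  "\<sigma> \<in> L \<longleftrightarrow> \<sigma> \<noteq> {} \<and> \<sigma> \<subseteq> D \<and> (\<forall>n\<in>\<sigma>. \<forall>m\<in>\<sigma>. (n, m) \<in> E ^^ r)"
proof -
  have "\<sigma> \<subseteq> D \<Longrightarrow> (\<forall>n\<in>\<sigma>. \<forall>m\<in>\<sigma>. n \<noteq> m \<longrightarrow> (n, m) \<in> parcs (distance_power G r)) \<longleftrightarrow>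
      (\<forall>n\<in>\<sigma>. \<forall>m\<in>\<sigma>. (n, m) \<in> E ^^ r)"
    unfolding parcs_distance_power_G using relpow_E_refl by (metis subsetD)
  moreover have "pverts (distance_power G r) = D"
    by (simp add: distance_power_def G_def)
  moreover have "\<sigma> \<subseteq> D \<Longrightarrow> finite \<sigma>"
    by (rule finite_subset[OF _ finite_D])
  ultimately show ?thesis
    unfolding clique_complex_def is_clique_def mem_Collect_eq by (cases "\<sigma> \<subseteq> D") simp_all
qed

text \<open>Summing over the fixed set \<open>D\<close> instead of the support and testing cliques
  pairwise suits weights that are themselves given by sums.\<close>

lemma realization_L_iff:
  "q \<in> realization_points L \<longleftrightarrow> (\<forall>n. 0 \<le> q n) \<and> {n. q n \<noteq> 0} \<subseteq> D \<and> (\<Sum>n\<in>D. q n) = 1 \<and>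
     (\<forall>n m. q n \<noteq> 0 \<longrightarrow> q m \<noteq> 0 \<longrightarrow> (n, m) \<in> E ^^ r)"
proof
  assume q: "q \<in> realization_points L"
  then have "{n. q n \<noteq> 0} \<in> L"
    by (simp add: realization_points_def)
  then have supp: "{n. q n \<noteq> 0} \<subseteq> D" "\<forall>n m. q n \<noteq> 0 \<longrightarrow> q m \<noteq> 0 \<longrightarrow> (n, m) \<in> E ^^ r"
    unfolding clique_complex_iff by auto
  moreover have "\<forall>n. 0 \<le> q n"
    using q by (simp add: realization_points_def)
  ultimately show "(\<forall>n. 0 \<le> q n) \<and> {n. q n \<noteq> 0} \<subseteq> D \<and> (\<Sum>n\<in>D. q n) = 1 \<and>
     (\<forall>n m. q n \<noteq> 0 \<longrightarrow> q m \<noteq> 0 \<longrightarrow> (n, m) \<in> E ^^ r)"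
    using realization_points_sum[OF q finite_D supp(1)] by blast
next
  assume q: "(\<forall>n. 0 \<le> q n) \<and> {n. q n \<noteq> 0} \<subseteq> D \<and> (\<Sum>n\<in>D. q n) = 1 \<and>
     (\<forall>n m. q n \<noteq> 0 \<longrightarrow> q m \<noteq> 0 \<longrightarrow> (n, m) \<in> E ^^ r)"
  have "(\<Sum>n | q n \<noteq> 0. q n) = (\<Sum>n\<in>D. q n)"
    by (rule sum.mono_neutral_left[OF finite_D]) (use q in blast)+
  with q have sum: "(\<Sum>n | q n \<noteq> 0. q n) = 1"
    by metis
  then have "{n. q n \<noteq> 0} \<noteq> {}"
    by (metis sum.empty zero_neq_one)
  with q have "{n. q n \<noteq> 0} \<in> L"
    unfolding clique_complex_iff by blast
  with q sum show "q \<in> realization_points L"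
    unfolding realization_points_def by blast
qed

section \<open>Multilinear interpolation on the grid\<close>

text \<open>These are the multilinear weights of the corners of a unit cube containing
  \<open>\<zeta>\<close>.\<close>

definition interp :: "('a \<Rightarrow> real) \<Rightarrow> nat \<Rightarrow> real" where
  "interp \<zeta> n = (if n \<in> D then \<Prod>v\<in>\<Union>K. hat (\<zeta> v - real (c n v)) else 0)"

lemma interp_nonneg: "0 \<le> interp \<zeta> n"
  by (simp add: interp_def prod_nonneg hat_nonneg)

lemma sum_interp:
  assumes "\<zeta> \<in> real_grid K M"
  shows "(\<Sum>n\<in>D. interp \<zeta> n) = 1"
proof -
  have "(\<Sum>n\<in>D. interp \<zeta> n) = (\<Sum>n\<in>D. \<Prod>v\<in>\<Union>K. hat (\<zeta> v - real (c n v)))"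
    by (simp add: interp_def)
  also have "\<dots> = (\<Sum>x\<in>grid K M. \<Prod>v\<in>\<Union>K. hat (\<zeta> v - real (x v)))"
    by (rule sum.reindex_bij_betw[OF c])
  also have "\<dots> = 1"
    by (rule sum_prod_hat[OF K _ assms]) simp
  finally show ?thesis .
qed

definition near :: "nat \<Rightarrow> ('a \<Rightarrow> real) \<Rightarrow> bool" where
  "near n \<zeta> \<longleftrightarrow> n \<in> D \<and> (\<forall>v. \<bar>\<zeta> v - real (c n v)\<bar> < 1)"

lemma near_exists:
  assumes "\<zeta> \<in> real_grid K M"
  shows "\<exists>n. near n \<zeta>"
proof -
  obtain x where "x \<in> grid K M" "\<forall>v. \<bar>\<zeta> v - real (x v)\<bar> < 1"
    using real_grid_rounding_exists[OF complex_K _ assms] by auto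
  moreover from this c obtain n where "n \<in> D" "c n = x"
    by (metis bij_betw_iff_bijections)
  ultimately show ?thesis
    by (auto simp: near_def)
qed

lemma interp_neq_0_imp_near:
  assumes "interp \<zeta> n \<noteq> 0" "\<And>v. v \<notin> \<Union>K \<Longrightarrow> \<zeta> v = 0"
  shows "near n \<zeta>"
proof -
  have n: "n \<in> D" and *: "\<forall>v\<in>\<Union>K. \<bar>\<zeta> v - real (c n v)\<bar> < 1"
    using assms(1) finite_V by (auto simp: interp_def hat_neq_0_iff split: if_splits)
  have "\<bar>\<zeta> v - real (c n v)\<bar> < 1" for v
    using * assms(2)[of v] c_outside[OF n, of v] by (cases "v \<in> \<Union>K") (blast, simp)
  with n show ?thesis
    by (simp add: near_def)
qed

lemma interp_c:
  assumes "n \<in> D"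
  shows "interp (\<lambda>v. real (c n v)) m = (if m = n then 1 else 0)"
proof (cases "m = n")
  case True
  with assms show ?thesis by (simp add: interp_def hat_def)
next
  case False
  have "interp (\<lambda>v. real (c n v)) m = 0"
  proof (rule ccontr)
    assume "interp (\<lambda>v. real (c n v)) m \<noteq> 0"
    then have "near m (\<lambda>v. real (c n v))"
      by (rule interp_neq_0_imp_near) (use c_outside assms in auto)
    then have "c m v = c n v" and m: "m \<in> D" for v
      by (auto simp: near_def dest!: spec[of _ v])
    then have "c m = c n" by auto
    with False m assms c show False
      by (auto simp: bij_betw_def dest: inj_onD)
  qed
  with False show ?thesis by simp
qed

section \<open>Rescaling the realization to the cube\<close>

text \<open>
  Some coordinate of a point of the realization is at least \<open>1 / card (\<Union>K)\<close>, so truncation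
  makes the largest coordinate equal to \<open>M\<close> without dividing by the maximum.
\<close>

definition scale :: "('a \<Rightarrow> real) \<Rightarrow> 'a \<Rightarrow> real" where
  "scale y v = real M * min 1 (real (card (\<Union>K)) * y v)"

lemma realization_K_outside: "y \<in> realization_points K \<Longrightarrow> v \<notin> \<Union>K \<Longrightarrow> y v = 0"
  by (auto simp: realization_points_def)

lemma scale_bounds:
  assumes "y \<in> realization_points K"
  shows "0 \<le> scale y v" "scale y v \<le> real M"
proof -
  have "0 \<le> y v"
    using assms by (auto simp: realization_points_def)
  then have "0 \<le> min 1 (real (card (\<Union>K)) * y v)"
    by simp
  then show "0 \<le> scale y v"
    unfolding scale_def by (intro mult_nonneg_nonneg) auto
  show "scale y v \<le> real M"
    unfolding scale_def by (intro mult_left_le) auto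
qed

lemma scale_neq_0:
  assumes "scale y v \<noteq> 0"
  shows "y v \<noteq> 0"
  using assms by (auto simp: scale_def)

lemma scale_max:
  assumes y: "y \<in> realization_points K"
  shows "\<exists>v. scale y v = real M"
proof (rule ccontr)
  assume neg: "\<nexists>v. scale y v = real M"
  have less: "real (card (\<Union>K)) * y v < 1" for v
    using neg by (auto simp: scale_def min_def not_le dest!: spec[of _ v] split: if_splits)
  have sum: "(\<Sum>v\<in>\<Union>K. y v) = 1"
    by (rule realization_points_sum[OF y finite_V]) (use realization_K_outside[OF y] in auto)
  then have "\<Union>K \<noteq> {}"
    by (metis sum.empty zero_neq_one)
  with less have "(\<Sum>v\<in>\<Union>K. real (card (\<Union>K)) * y v) < (\<Sum>v\<in>\<Union>K. 1)"
    by (intro sum_strict_mono finite_V) auto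
  then show False
    using sum by (simp flip: sum_distrib_left)
qed

lemma scale_real_grid:
  assumes y: "y \<in> realization_points K"
  shows "scale y \<in> real_grid K M"
proof -
  obtain u where u: "scale y u = real M"
    using scale_max[OF y] by auto
  have "{v. y v \<noteq> 0} \<in> K"
    using y by (auto simp: realization_points_def)
  moreover have "{v. scale y v \<noteq> 0} \<subseteq> {v. y v \<noteq> 0}"
    using scale_neq_0 by auto
  moreover have "{v. scale y v \<noteq> 0} \<noteq> {}"
    using u by force
  ultimately have "{v. scale y v \<noteq> 0} \<in> K"
    using complex_K unfolding abstract_simplicial_complex_def by blast
  with u scale_bounds[OF y] show ?thesis
    by (auto simp: real_grid_def)
qed

section \<open>Sliding the vertices of a clique to a common point\<close>

text \<open>
  The upper bound stays at \<open>M\<close> until \<open>t = 1/2\<close>, when the lower bound has reached \<open>scale y\<close>;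
  so at every time some coordinate equals \<open>M\<close>.
\<close>

definition slide :: "real \<Rightarrow> ('a \<Rightarrow> real) \<Rightarrow> nat \<Rightarrow> 'a \<Rightarrow> real" where
  "slide t y n v = clamp (min 1 (2 * t) * scale y v)
     (real M - max 0 (2 * t - 1) * (real M - scale y v)) (real (c n v))"

lemma slide_bounds:
  assumes "y \<in> realization_points K" "0 \<le> t" "t \<le> 1"
  shows "0 \<le> min 1 (2 * t) * scale y v"
    and "min 1 (2 * t) * scale y v \<le> real M - max 0 (2 * t - 1) * (real M - scale y v)"
    and "real M - max 0 (2 * t - 1) * (real M - scale y v) \<le> real M"
proof -
  note s = scale_bounds[OF assms(1), of v]
  show "0 \<le> min 1 (2 * t) * scale y v"
    using s assms by simp
  have "min 1 (2 * t) * scale y v \<le> 1 * scale y v"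
    using s by (intro mult_right_mono) auto
  moreover have "max 0 (2 * t - 1) * (real M - scale y v) \<le> 1 * (real M - scale y v)"
    using s assms by (intro mult_right_mono) auto
  ultimately show "min 1 (2 * t) * scale y v \<le> real M - max 0 (2 * t - 1) * (real M - scale y v)"
    by simp
  have "0 \<le> max 0 (2 * t - 1) * (real M - scale y v)"
    using s by (intro mult_nonneg_nonneg) auto
  then show "real M - max 0 (2 * t - 1) * (real M - scale y v) \<le> real M"
    by simp
qed

lemma slide_0: "y \<in> realization_points K \<Longrightarrow> n \<in> D \<Longrightarrow> slide 0 y n v = real (c n v)"
  using c_le[of n v] by (auto simp: slide_def clamp_def)

lemma slide_1: "y \<in> realization_points K \<Longrightarrow> slide 1 y n = scale y"
  by (auto simp: slide_def clamp_def)

text \<open>Where \<open>c n\<close> vanishes so does \<open>scale y\<close>. The lower end of the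
  box is then 0 and the coordinate stays 0, so the support remains within the simplex of
  \<open>c n\<close>.\<close>

lemma slide_real_grid:
  assumes y: "y \<in> realization_points K" and t: "0 \<le> t" "t \<le> 1" and n: "n \<in> D"
    and supp: "\<And>v. y v \<noteq> 0 \<Longrightarrow> c n v \<noteq> 0"
  shows "slide t y n \<in> real_grid K M"
proof -
  note b = slide_bounds[OF y t]
  have bounds: "0 \<le> slide t y n v" "slide t y n v \<le> real M" for v
    using b[of v] unfolding slide_def clamp_def by linarith+
  have sub: "{v. slide t y n v \<noteq> 0} \<subseteq> {v. c n v \<noteq> 0}"
  proof
    fix v assume v: "v \<in> {v. slide t y n v \<noteq> 0}"
    show "v \<in> {v. c n v \<noteq> 0}"
    proof (rule ccontr)
      assume "v \<notin> {v. c n v \<noteq> 0}"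
      then have "c n v = 0" "scale y v = 0"
        using supp[of v] scale_neq_0[of y v] by auto
      with v b[of v] show False
        by (auto simp: slide_def clamp_def)
    qed
  qed
  have "\<exists>u. slide t y n u = real M"
  \<comment> \<open>In the first half a coordinate \<open>M\<close> of the vertex is not cut; in the
    second half the lower bound forces the value \<open>M\<close> where \<open>scale y\<close>
    attains it.\<close>
  proof (cases "t \<le> 1 / 2")
    case True
    obtain u where "c n u = M" using c_max[OF n] by auto
    with True b[of u] show ?thesis
      by (intro exI[of _ u]) (auto simp: slide_def clamp_def)
  next
    case False
    obtain u where "scale y u = real M" using scale_max[OF y] by auto
    with False c_le[OF n, of u] show ?thesis
      by (intro exI[of _ u]) (auto simp: slide_def clamp_def)
  qed
  then obtain u where u: "slide t y n u = real M" by auto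
  then have "{v. slide t y n v \<noteq> 0} \<noteq> {}"
    by force
  with sub c_supp[OF n] have "{v. slide t y n v \<noteq> 0} \<in> K"
    using complex_K unfolding abstract_simplicial_complex_def by blast
  with u bounds show ?thesis
    by (auto simp: real_grid_def)
qed

text \<open>Both points are clamped to the same box, so \<open>clamp_rounding\<close> applies to
  each coordinate in both directions. The case \<open>n = m\<close> compares two roundings of one
  point.\<close>

lemma near_slide_E:
  assumes y: "y \<in> realization_points K" and t: "0 \<le> t" "t \<le> 1"
    and "(n, m) \<in> E" "near w (slide t y n)" "near w' (slide t y m)"
  shows "(w, w') \<in> E"
proof -
  have "c w v \<le> c w' v + 1" "c w' v \<le> c w v + 1" for v
    using clamp_rounding[OF _ _ slide_bounds(2)[OF y t, of v], of "c n v" "c m v" "c w v" "c w' v"]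
      clamp_rounding[OF _ _ slide_bounds(2)[OF y t, of v], of "c m v" "c n v" "c w' v" "c w v"]
      assms(4-6)
    by (auto simp: near_def slide_def E_def)
  then show ?thesis
    using assms(5,6) by (auto simp: near_def E_def)
qed

text \<open>Every intermediate vertex of the walk is still positive on the support of
  \<open>y\<close>, so its slide lies in \<open>real_grid\<close> and can be rounded to a vertex. At
  least one step is required because two roundings of the same point may differ.\<close>

lemma near_slide_relpow:
  assumes y: "y \<in> realization_points K" and t: "0 \<le> t" "t \<le> 1" and n: "n \<in> D"
    and "(n, m) \<in> E ^^ Suc l" "\<And>v. y v \<noteq> 0 \<Longrightarrow> Suc l < c n v"
    and "near w (slide t y n)" "near w' (slide t y m)"
  shows "(w, w') \<in> E ^^ Suc l"
  using assms(5,6,8)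
proof (induct l arbitrary: m w')
  case 0
  then show ?case
    using near_slide_E[OF y t _ assms(7)] by auto
next
  case (Suc l)
  from Suc.prems(1) obtain k where k: "(n, k) \<in> E ^^ Suc l" "(k, m) \<in> E"
    by (meson relpow_Suc_E)
  have "c k v \<noteq> 0" if "y v \<noteq> 0" for v
    using relpow_E_le[OF k(1), of v] Suc.prems(2)[OF that] by linarith
  then obtain z where z: "near z (slide t y k)"
    using near_exists[OF slide_real_grid[OF y t relpow_E_D[OF k(1) n]]] by blast
  have "(w, z) \<in> E ^^ Suc l"
    by (rule Suc.hyps[OF k(1) _ z]) (use Suc.prems(2) in fastforce)
  with near_slide_E[OF y t k(2) z Suc.prems(3)] show ?case
    by (meson relpow_Suc_I)
qed

section \<open>The maps between the two realizations\<close>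

definition bary :: "(nat \<Rightarrow> real) \<Rightarrow> 'a \<Rightarrow> real" where
  "bary q v = (\<Sum>n\<in>D. q n * real (c n v))"

definition to_K :: "(nat \<Rightarrow> real) \<Rightarrow> 'a \<Rightarrow> real" where
  "to_K q v = max 0 (bary q v - real (2 * r)) / (\<Sum>u\<in>\<Union>K. max 0 (bary q u - real (2 * r)))"

definition from_K :: "('a \<Rightarrow> real) \<Rightarrow> nat \<Rightarrow> real" where
  "from_K y = interp (scale y)"

text \<open>If an average exceeds \<open>2 * r\<close>, so does one of the averaged values; all
  other vertices of the clique are within \<open>r\<close> of it.\<close>

lemma to_K_neq_0_imp:
  assumes q: "q \<in> realization_points L" and "to_K q v \<noteq> 0" "q n \<noteq> 0"
  shows "r < c n v"
proof -
  note q' = q[unfolded realization_L_iff]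
  have gt: "bary q v > real (2 * r)"
    using assms(2) by (auto simp: to_K_def max_def split: if_splits)
  obtain m where m: "q m \<noteq> 0" "2 * r < c m v"
  proof (rule ccontr)
    assume "\<not> thesis"
    then have neg: "c m v \<le> 2 * r" if "q m \<noteq> 0" for m
      using that \<open>\<And>m. q m \<noteq> 0 \<Longrightarrow> 2 * r < c m v \<Longrightarrow> thesis\<close> by force
    have "q m * real (c m v) \<le> q m * real (2 * r)" for m
    proof (cases "q m = 0")
      case False
      have "real (c m v) \<le> real (2 * r)"
        using neg[OF False] by (simp only: of_nat_le_iff)
      then show ?thesis
        using q' by (intro mult_left_mono) auto
    qed simp
    then have "bary q v \<le> (\<Sum>m\<in>D. q m * real (2 * r))"
      unfolding bary_def by (rule sum_mono)
    also have "\<dots> = real (2 * r)"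
      using q' by (simp flip: sum_distrib_right)
    finally show False using gt by simp
  qed
  have "(m, n) \<in> E ^^ r"
    using q' m(1) assms(3) by blast
  then show ?thesis
    using relpow_E_le[of m n r v] m(2) by linarith
qed

lemma realization_L_vertex:
  assumes q: "q \<in> realization_points L"
  obtains n where "n \<in> D" "q n \<noteq> 0"
proof -
  have "{n. q n \<noteq> 0} \<noteq> {}" "{n. q n \<noteq> 0} \<subseteq> D"
    using q by (auto simp: realization_points_def clique_complex_iff)
  then show thesis using that by auto
qed

text \<open>If one vertex has \<open>u\<close>-coordinate \<open>M\<close>, all vertices of the
  clique have at least \<open>2 * r + 1\<close> there, and so has the barycentre.\<close>

lemma to_K_denominator_pos:
  assumes q: "q \<in> realization_points L"
  shows "0 < (\<Sum>u\<in>\<Union>K. max 0 (bary q u - real (2 * r)))"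
proof -
  note q' = q[unfolded realization_L_iff]
  obtain n where n: "n \<in> D" "q n \<noteq> 0"
    using realization_L_vertex[OF q] by auto
  obtain u where u: "c n u = M"
    using c_max[OF n(1)] by auto
  have "q m * real (2 * r + 1) \<le> q m * real (c m u)" for m
  proof (cases "q m = 0")
    case False
    have "(n, m) \<in> E ^^ r"
      using q' n(2) False by blast
    then have "2 * r + 1 \<le> c m u"
      using relpow_E_le[of n m r u] u by linarith
    then have "real (2 * r + 1) \<le> real (c m u)"
      by (simp only: of_nat_le_iff)
    then show ?thesis
      using q' by (intro mult_left_mono) auto
  qed simp
  then have "(\<Sum>m\<in>D. q m * real (2 * r + 1)) \<le> bary q u"
    unfolding bary_def by (rule sum_mono)
  moreover have "(\<Sum>m\<in>D. q m * real (2 * r + 1)) = real (2 * r + 1)"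
    using q' by (simp flip: sum_distrib_right)
  ultimately have "0 < max 0 (bary q u - real (2 * r))"
    by simp
  moreover have "u \<in> \<Union>K"
    using c_outside[OF n(1), of u] u by force
  ultimately show ?thesis
    by (intro sum_pos2[OF finite_V, of u]) auto
qed

text \<open>Any single vertex \<open>n\<close> of the clique provides a simplex, the support of
  \<open>c n\<close>, that contains the support of the image.\<close>

lemma to_K_realization:
  assumes q: "q \<in> realization_points L"
  shows "to_K q \<in> realization_points K"
proof -
  obtain n where n: "n \<in> D" "q n \<noteq> 0"
    using realization_L_vertex[OF q] by auto
  let ?\<sigma> = "{v. c n v \<noteq> 0}"
  have supp: "{v. to_K q v \<noteq> 0} \<subseteq> ?\<sigma>"
    using to_K_neq_0_imp[OF q _ n(2)] by fastforce
  have sub: "?\<sigma> \<subseteq> \<Union>K"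
    using c_supp[OF n(1)] by auto
  show ?thesis
  proof (rule realization_pointsI[OF complex_K c_supp[OF n(1)] _ supp])
    show "0 \<le> to_K q v" for v
      using to_K_denominator_pos[OF q] by (simp add: to_K_def)
    have "(\<Sum>v\<in>?\<sigma>. to_K q v) = (\<Sum>v\<in>\<Union>K. to_K q v)"
      by (rule sum.mono_neutral_left[OF finite_V sub]) (use supp in auto)
    also have "\<dots> = 1"
      using to_K_denominator_pos[OF q] by (simp add: to_K_def flip: sum_divide_distrib)
    finally show "(\<Sum>v\<in>?\<sigma>. to_K q v) = 1" .
  qed
qed

section \<open>The homotopy on the clique complex\<close>

lemma slide_outside:
  assumes "y \<in> realization_points K" "n \<in> D" "v \<notin> \<Union>K" "0 \<le> t" "t \<le> 1"
  shows "slide t y n v = 0"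
  using slide_bounds[OF assms(1,4,5), of v] c_outside[OF assms(2,3)]
    scale_neq_0[of y v] realization_K_outside[OF assms(1,3)]
  by (auto simp: slide_def clamp_def)

definition deform :: "real \<Rightarrow> (nat \<Rightarrow> real) \<Rightarrow> nat \<Rightarrow> real" where
  "deform t q w = (\<Sum>n\<in>D. q n * interp (slide t (to_K q) n) w)"

lemma deform_0:
  assumes q: "q \<in> realization_points L"
  shows "deform 0 q = q"
proof
  fix w
  have "deform 0 q w = (\<Sum>n\<in>D. q n * (if w = n then 1 else 0))"
    unfolding deform_def
  proof (rule sum.cong)
    fix n assume n: "n \<in> D"
    then have "slide 0 (to_K q) n = (\<lambda>v. real (c n v))"
      using slide_0[OF to_K_realization[OF q]] by auto
    then show "q n * interp (slide 0 (to_K q) n) w = q n * (if w = n then 1 else 0)"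
      using interp_c[OF n] by simp
  qed simp
  also have "\<dots> = (if w \<in> D then q w else 0)"
    using finite_D by (simp add: if_distrib[of "\<lambda>z. _ * z"] sum.delta' cong: if_cong)
  also have "\<dots> = q w"
    using q[unfolded realization_L_iff] by auto
  finally show "deform 0 q w = q w" .
qed

text \<open>At time 1 the box is a point, so all slides end at \<open>scale (to_K q)\<close> and the
  total weight 1 factors out.\<close>

lemma deform_1:
  assumes q: "q \<in> realization_points L"
  shows "deform 1 q = from_K (to_K q)"
proof
  fix w
  have "deform 1 q w = (\<Sum>n\<in>D. q n) * interp (scale (to_K q)) w"
    by (simp add: deform_def slide_1[OF to_K_realization[OF q]] sum_distrib_right)
  then show "deform 1 q w = from_K (to_K q) w"
    using q[unfolded realization_L_iff] by (simp add: from_K_def)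
qed

text \<open>Vertices that receive weight are roundings of slides of vertices of one clique. By
  \<open>to_K_neq_0_imp\<close> the latter have coordinates above \<open>r\<close> on the support of
  \<open>to_K q\<close>, which is what \<open>near_slide_relpow\<close> asks for.\<close>

lemma deform_realization:
  assumes q: "q \<in> realization_points L" and t: "0 \<le> t" "t \<le> 1"
  shows "deform t q \<in> realization_points L"
proof -
  note q' = q[unfolded realization_L_iff] and y = to_K_realization[OF q]
  have grid: "slide t (to_K q) n \<in> real_grid K M" if "q n \<noteq> 0" for n
  proof (rule slide_real_grid[OF y t])
    show "n \<in> D" using q' that by auto
    show "c n v \<noteq> 0" if "to_K q v \<noteq> 0" for v
      using to_K_neq_0_imp[OF q that \<open>q n \<noteq> 0\<close>] by auto
  qed
  have supp: "\<exists>n\<in>D. q n \<noteq> 0 \<and> near w (slide t (to_K q) n)" if w: "deform t q w \<noteq> 0" for w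
  proof -
    obtain n where n: "n \<in> D" "q n * interp (slide t (to_K q) n) w \<noteq> 0"
      by (rule sum.not_neutral_contains_not_neutral[OF w[unfolded deform_def]])
    then have "near w (slide t (to_K q) n)"
      by (intro interp_neq_0_imp_near) (use slide_outside[OF y n(1) _ t] in auto)
    with n show ?thesis by auto
  qed
  have "0 \<le> deform t q w" for w
    using q' unfolding deform_def by (intro sum_nonneg mult_nonneg_nonneg interp_nonneg) auto
  moreover have "{w. deform t q w \<noteq> 0} \<subseteq> D"
    using supp by (auto simp: near_def)
  moreover have "(\<Sum>w\<in>D. deform t q w) = 1"
  proof -
    have "(\<Sum>w\<in>D. deform t q w) = (\<Sum>n\<in>D. q n * (\<Sum>w\<in>D. interp (slide t (to_K q) n) w))"
      unfolding deform_def by (subst sum.swap) (simp add: sum_distrib_left)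
    also have "\<dots> = (\<Sum>n\<in>D. q n)"
    proof (rule sum.cong)
      fix n
      show "q n * (\<Sum>w\<in>D. interp (slide t (to_K q) n) w) = q n"
        \<comment> \<open>Slides of vertices of weight 0 may leave \<open>real_grid\<close>, but
          they contribute nothing.\<close>
        by (cases "q n = 0") (simp_all add: sum_interp[OF grid])
    qed simp
    finally show ?thesis using q' by simp
  qed
  moreover have "(w, w') \<in> E ^^ r" if ww: "deform t q w \<noteq> 0" "deform t q w' \<noteq> 0" for w w'
  proof -
    obtain n where n: "n \<in> D" "q n \<noteq> 0" "near w (slide t (to_K q) n)"
      using supp[OF ww(1)] by auto
    obtain m where m: "q m \<noteq> 0" "near w' (slide t (to_K q) m)"
      using supp[OF ww(2)] by auto
    obtain l where l: "r = Suc l"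
      using r by (cases r) auto
    show ?thesis
      unfolding l
      by (rule near_slide_relpow[OF y t n(1) _ _ n(3) m(2)])
        (use q' n(2) m(1) to_K_neq_0_imp[OF q _ n(2)] in \<open>simp_all flip: l del: relpow.simps\<close>)
  qed
  ultimately show ?thesis
    unfolding realization_L_iff by auto
qed

lemma from_K_realization:
  assumes y: "y \<in> realization_points K"
  shows "from_K y \<in> realization_points L"
  unfolding realization_L_iff
proof (intro conjI allI impI)
  note grid = scale_real_grid[OF y]
  have near: "near n (scale y)" if "from_K y n \<noteq> 0" for n
    using that scale_neq_0[of y] realization_K_outside[OF y] unfolding from_K_def
    by (intro interp_neq_0_imp_near) auto
  show "0 \<le> from_K y n" for n
    by (simp add: from_K_def interp_nonneg)
  show "{n. from_K y n \<noteq> 0} \<subseteq> D"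
    using near by (auto simp: near_def)
  show "(\<Sum>n\<in>D. from_K y n) = 1"
    using sum_interp[OF grid] by (simp add: from_K_def)
  fix n m assume "from_K y n \<noteq> 0" "from_K y m \<noteq> 0"
  \<comment> \<open>At time 1 every slide equals \<open>scale y\<close>, so the loop at
    \<open>n\<close> yields adjacency of any two roundings of \<open>scale y\<close>.\<close>
  with near have nm: "near n (slide 1 y n)" "near m (slide 1 y n)" "n \<in> D" "m \<in> D"
    by (auto simp: slide_1[OF y] near_def)
  have "(n, m) \<in> E"
    by (rule near_slide_E[OF y _ _ _ nm(1,2)]) (use nm(3) in \<open>simp_all add: E_def\<close>)
  then have "(n, m) \<in> E ^^ Suc (r - 1)"
    using relpow_E_refl[OF nm(3), of "r - 1"] by (meson relpow_Suc_I)
  then show "(n, m) \<in> E ^^ r"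
    using r by simp
qed

text \<open>Rounding creates no new support. This is the support condition for the straight-line
  homotopy from the identity to \<open>to_K \<circ> from_K\<close>.\<close>

lemma to_from_K_supp:
  assumes y: "y \<in> realization_points K" and "to_K (from_K y) v \<noteq> 0"
  shows "y v \<noteq> 0"
proof -
  have "bary (from_K y) v \<noteq> 0"
    using assms(2) by (auto simp: to_K_def)
  then have "\<exists>n\<in>D. from_K y n * real (c n v) \<noteq> 0"
    unfolding bary_def by (rule contrapos_np) (simp add: sum.neutral)
  then obtain n where n: "n \<in> D" "from_K y n \<noteq> 0" "c n v \<noteq> 0"
    by auto
  then have "near n (scale y)"
    using scale_neq_0[of y] realization_K_outside[OF y] unfolding from_K_def
    by (intro interp_neq_0_imp_near) auto
  then have "\<bar>scale y v - real (c n v)\<bar> < 1"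
    by (auto simp: near_def)
  with n(3) have "scale y v \<noteq> 0"
    by (cases "c n v") auto
  then show ?thesis
    by (rule scale_neq_0)
qed

section \<open>Continuity and the homotopy equivalence\<close>

lemma continuous_on_interp:
  assumes "\<And>v. continuous_on S (\<lambda>x. \<zeta> x v)"
  shows "continuous_on S (\<lambda>x. interp (\<zeta> x) n)"
  unfolding interp_def hat_def by (cases "n \<in> D") (auto intro!: continuous_intros assms)

lemma continuous_on_scale:
  assumes "continuous_on S (\<lambda>x. y x v)"
  shows "continuous_on S (\<lambda>x. scale (y x) v)"
  unfolding scale_def by (intro continuous_intros assms)

lemma continuous_on_from_K: "continuous_on S from_K"
  unfolding from_K_def
  by (intro continuous_on_coordinatewise_then_product continuous_on_interp continuous_on_scale
      continuous_on_subset[OF continuous_on_product_coordinates]) auto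

lemma continuous_on_to_K:
  assumes q: "\<And>n. continuous_on S (\<lambda>x. q x n)" and L: "\<And>x. x \<in> S \<Longrightarrow> q x \<in> realization_points L"
  shows "continuous_on S (\<lambda>x. to_K (q x) v)"
proof -
  have "continuous_on S (\<lambda>x. bary (q x) u)" for u
    unfolding bary_def by (intro continuous_intros q)
  then show ?thesis
    unfolding to_K_def using to_K_denominator_pos[OF L]
    by (intro continuous_intros ballI) force+
qed

lemma continuous_on_deform:
  "continuous_on ({0..1} \<times> realization_points L) (\<lambda>p. deform (fst p) (snd p))"
proof -
  let ?S = "{0..1::real} \<times> realization_points L"
  have q: "continuous_on ?S (\<lambda>p. snd p n)" for n
    by (intro continuous_on_product_then_coordinatewise[OF continuous_on_snd] continuous_on_id)
  have "continuous_on ?S (\<lambda>p. to_K (snd p) v)" for v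
    by (rule continuous_on_to_K[OF q]) auto
  then have "continuous_on ?S (\<lambda>p. slide (fst p) (to_K (snd p)) n v)" for n v
    unfolding slide_def clamp_def by (intro continuous_intros continuous_on_scale)
  then show ?thesis
    unfolding deform_def
    by (intro continuous_on_coordinatewise_then_product continuous_intros continuous_on_interp q)
qed

lemma homotopy_equivalent_power_clique_complex:
  "geometric_realization L homotopy_equivalent_space geometric_realization K"
proof -
  let ?P = "realization_points K" and ?Q = "realization_points L"
  have cont_to: "continuous_on ?Q to_K"
    by (intro continuous_on_coordinatewise_then_product continuous_on_to_K
        continuous_on_subset[OF continuous_on_product_coordinates]) auto
  have "homotopic_with_canon (\<lambda>_. True) ?Q ?Q id (from_K \<circ> to_K)"
    using continuous_on_deform deform_realization
    by (subst homotopic_with)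
      (auto intro!: exI[of _ "\<lambda>p. deform (fst p) (snd p)"] simp: deform_0 deform_1)
  moreover have "homotopic_with_canon (\<lambda>_. True) ?P ?P id (to_K \<circ> from_K)"
  proof (rule homotopic_straight_line_realization[OF complex_K])
    show "continuous_on ?P (to_K \<circ> from_K)"
      by (intro continuous_on_compose continuous_on_from_K continuous_on_subset[OF cont_to])
        (use from_K_realization in auto)
  qed (auto simp: from_K_realization to_K_realization to_from_K_supp)
  moreover have "continuous_map (top_of_set ?Q) (top_of_set ?P) to_K"
    "continuous_map (top_of_set ?P) (top_of_set ?Q) from_K"
    using cont_to continuous_on_from_K to_K_realization from_K_realization by auto
  ultimately show ?thesis
    unfolding geometric_realization_eq_top_of_set homotopy_equivalent_space_def
    by (meson homotopic_with_symD)
qed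

end

theorem theorem4p1:
  fixes K :: "'a set set" and r :: nat
  assumes "finite_simplicial_complex K"
    and "r \<ge> 1"
  shows "\<exists>G :: nat pair_pre_digraph. pair_graph G \<and>
    geometric_realization (clique_complex (distance_power G r))
      homotopy_equivalent_space geometric_realization K"
proof -
  \<comment> \<open>If \<open>K\<close> is empty, so is the grid, and the graph has no
    vertices.\<close>
  obtain c where "bij_betw c {0..<card (grid K (3 * r + 1))} (grid K (3 * r + 1))"
    using ex_bij_betw_nat_finite[OF finite_grid[OF assms(1)]] by blast
  then interpret grid_graph K r "{0..<card (grid K (3 * r + 1))}" c
    using assms by unfold_locales
  show ?thesis
    using pair_graph_G homotopy_equivalent_power_clique_complex by blast
qed

end
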